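(* Let $\alpha,\beta\in(0,\infty]$ and let $a:=\alpha^{-1}$, $b:=\beta^{-1}$ (with $\infty^{-1}=0$). Let $n\ge1$, and if $\alpha=\beta=\infty$ assume $n\ge 2$ for the expectation formula and $n\ge3$ for the variance formula. Let $A_{n,\alpha,\beta}=A(S_{n,\alpha,\beta})$ be the number of symbols $\alpha$ on the diagonal of the random $\alpha/\beta$-staircase tableau $S_{n,\alpha,\beta}$. Then $$\mathbb E(A_{n,\alpha,\beta})=\frac{n(n+2b-1)}{2(n+a+b-1)}$$ and $$\operatorname{Var}(A_{n,\alpha,\beta})=n\,\frac{(n-1)(n-2)(n+4a+4b-1)+6(n-1)(a+b)^2+12ab(a+b-1)}{12(n+a+b-1)^2(n+a+b-2)},$$ where for $n=1$ and $a+b=1$ the last expression, which is of the form $0/0$, is interpreted by continuity in $(a,b)$ (i.e. after cancelling the common factor $a+b-1$).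
   Context: An $\alpha/\beta$-staircase tableau of size $n\ge1$ is a filling of the Young diagram of shape $(n,n-1,\dots,2,1)$, whose boxes are $(i,j)$ (row $i$ from the top, column $j$ from the left) with $i,j\ge1$, $i+j\le n+1$, such that: each box is empty or contains one of the symbols $\alpha,\beta$; no diagonal box (box with $i+j=n+1$) is empty; all boxes in the same row and to the left of a $\beta$ are empty; all boxes in the same column and above an $\alpha$ are empty. Let $\bar{\mathcal S}_n$ be the set of these tableaux. For $S\in\bar{\mathcal S}_n$ let $N_\alpha(S),N_\beta(S)$ be the numbers of symbols $\alpha$ and $\beta$ in $S$, and $A(S)$ the number of symbols $\alpha$ in diagonal boxes. For parameter values $\alpha,\beta\in(0,\infty)$, $S_{n,\alpha,\beta}$ is the random element of $\bar{\mathcal S}_n$ with $\mathbb P(S_{n,\alpha,\beta}=S)=\alpha^{N_\alpha(S)}\beta^{N_\beta(S)}/Z_n(\alpha,\beta)$, where $Z_n(\alpha,\beta)=\sum_{S\in\bar{\mathcal S}_n}\alpha^{N_\alpha(S)}\beta^{N_\beta(S)}$. If exactly one of $\alpha,\beta$ is $\infty$, the distribution is the limit of this one as that parameter tends to $\infty$ with the other fixed; if $\alpha=\beta=\infty$, it is the limit as $\alpha=\beta\to\infty$. *)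

theory Defs
  imports "HOL-Probability.Probability"
begin

datatype symb = Alpha | Beta

definition boxes :: "nat \<Rightarrow> (nat \<times> nat) set" where
  "boxes n = {(i, j). 1 \<le> i \<and> 1 \<le> j \<and> i + j \<le> n + 1}"

definition diagonal :: "nat \<Rightarrow> (nat \<times> nat) set" where
  "diagonal n = {(i, j) \<in> boxes n. i + j = n + 1}"

text \<open>
  A filling is a partial map; \<open>None\<close> stands for an empty box, and the map is undefined
  outside the diagram, so that fillings are determined by their values on the boxes.
\<close>

definition tableaux :: "nat \<Rightarrow> (nat \<times> nat \<rightharpoonup> symb) set" where
  "tableaux n = {S. dom S \<subseteq> boxes n \<and> diagonal n \<subseteq> dom S \<and>
     (\<forall>i j j'. S (i, j) = Some Beta \<and> j' < j \<longrightarrow> S (i, j') = None) \<and>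
     (\<forall>i j i'. S (i, j) = Some Alpha \<and> i' < i \<longrightarrow> S (i', j) = None)}"

definition num_symb :: "symb \<Rightarrow> (nat \<times> nat \<rightharpoonup> symb) \<Rightarrow> nat" where
  "num_symb s S = card {x. S x = Some s}"

definition diag_alphas :: "nat \<Rightarrow> (nat \<times> nat \<rightharpoonup> symb) \<Rightarrow> nat" where
  "diag_alphas n S = card {x \<in> diagonal n. S x = Some Alpha}"

definition weight :: "real \<Rightarrow> real \<Rightarrow> (nat \<times> nat \<rightharpoonup> symb) \<Rightarrow> real" where
  "weight x y S = x ^ num_symb Alpha S * y ^ num_symb Beta S"

definition partition_fun :: "nat \<Rightarrow> real \<Rightarrow> real \<Rightarrow> real" where
  "partition_fun n x y = (\<Sum>S\<in>tableaux n. weight x y S)"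

definition fin_tableau_pmf :: "nat \<Rightarrow> real \<Rightarrow> real \<Rightarrow> (nat \<times> nat \<rightharpoonup> symb) pmf" where
  "fin_tableau_pmf n x y =
     embed_pmf (\<lambda>S. if S \<in> tableaux n then weight x y S / partition_fun n x y else 0)"

text \<open>
  Infinite parameters are replaced by one common variable \<open>t\<close> tending to infinity; in
  particular, if both are infinite, the limit is taken along the diagonal.  That the limits
  exist and form a probability mass function is \<open>pmf_tableau_pmf_limit\<close> below.
\<close>

definition tableau_pmf :: "nat \<Rightarrow> ennreal \<Rightarrow> ennreal \<Rightarrow> (nat \<times> nat \<rightharpoonup> symb) pmf" where
  "tableau_pmf n \<alpha> \<beta> =
     (if \<alpha> < \<infinity> \<and> \<beta> < \<infinity> then fin_tableau_pmf n (enn2real \<alpha>) (enn2real \<beta>)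
      else embed_pmf (\<lambda>S. Lim at_top (\<lambda>t.
             pmf (fin_tableau_pmf n (if \<alpha> = \<infinity> then t else enn2real \<alpha>)
                                    (if \<beta> = \<infinity> then t else enn2real \<beta>)) S)))"

lemma finite_boxes: "finite (boxes n)"
  by (rule finite_subset[of _ "{..n+1} \<times> {..n+1}"]) (auto simp: boxes_def)

lemma finite_tableaux: "finite (tableaux n)"
proof (rule finite_subset)
  have "finite (UNIV :: symb set)"
    by (rule finite_subset[of _ "{Alpha, Beta}"]) (use symb.exhaust in auto)
  moreover have "{S. dom S \<subseteq> boxes n} = (\<Union>B\<in>Pow (boxes n). {S. dom S = B \<and> ran S \<subseteq> (UNIV :: symb set)})"
    by auto
  ultimately show "finite {S :: nat \<times> nat \<rightharpoonup> symb. dom S \<subseteq> boxes n}"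
    by (simp only:)
       (intro finite_UN_I finite_set_of_finite_maps, auto intro: finite_subset simp: finite_boxes)
qed (auto simp: tableaux_def)

lemma tableaux_nonempty: "tableaux n \<noteq> {}"
proof -
  have "(\<lambda>x. if x \<in> diagonal n then Some Alpha else None) \<in> tableaux n"
    by (auto simp: tableaux_def diagonal_def split: if_splits)
  then show ?thesis by blast
qed

lemma weight_pos: "0 < x \<Longrightarrow> 0 < y \<Longrightarrow> 0 < weight x y S"
  by (simp add: weight_def)

lemma partition_fun_pos: "0 < x \<Longrightarrow> 0 < y \<Longrightarrow> 0 < partition_fun n x y"
  unfolding partition_fun_def
  by (rule sum_pos) (auto simp: finite_tableaux tableaux_nonempty weight_pos)

lemma pmf_embed_finite:
  fixes p :: "'a \<Rightarrow> real"
  assumes "finite T" "\<And>S. S \<in> T \<Longrightarrow> 0 \<le> p S" "\<And>S. S \<notin> T \<Longrightarrow> p S = 0" "(\<Sum>S\<in>T. p S) = 1"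
  shows "pmf (embed_pmf p) S = p S"
proof (rule pmf_embed_pmf)
  show nn: "0 \<le> p x" for x using assms(2,3)[of x] by (cases "x \<in> T") auto
  have "(\<integral>\<^sup>+x. ennreal (p x) \<partial>count_space UNIV) = (\<Sum>x\<in>T. ennreal (p x))"
    by (rule nn_integral_count_space'[OF assms(1)]) (use assms(3) in auto)
  also have "\<dots> = 1" by (simp add: sum_ennreal nn assms(4))
  finally show "(\<integral>\<^sup>+x. ennreal (p x) \<partial>count_space UNIV) = 1" .
qed

lemma pmf_fin_tableau_pmf:
  assumes "0 < x" "0 < y"
  shows "pmf (fin_tableau_pmf n x y) S =
           (if S \<in> tableaux n then weight x y S / partition_fun n x y else 0)"
  unfolding fin_tableau_pmf_def
proof (rule pmf_embed_finite[OF finite_tableaux[of n]])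
  show "(\<Sum>S\<in>tableaux n. if S \<in> tableaux n then weight x y S / partition_fun n x y else 0) = 1"
    using partition_fun_pos[OF assms, of n]
    by (simp add: sum_divide_distrib[symmetric] flip: partition_fun_def)
qed (auto intro!: divide_nonneg_pos less_imp_le[OF weight_pos] partition_fun_pos assms)

lemma monomial_ratio_limit:
  fixes c :: "'a \<Rightarrow> real" and k :: "'a \<Rightarrow> nat"
  assumes T: "finite T" "S \<in> T" and c: "\<And>S. S \<in> T \<Longrightarrow> 0 < c S"
  shows "\<exists>l. ((\<lambda>t. c S * t ^ k S / (\<Sum>R\<in>T. c R * t ^ k R)) \<longlongrightarrow> l) at_top"
proof -
  define m where "m = Max (k ` T)"
  define e where "e R = (if k R = m then c R else 0)" for R
  have le: "k R \<le> m" if "R \<in> T" for R using that T by (auto simp: m_def)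
  have lim: "((\<lambda>t. c R * t ^ k R / t ^ m) \<longlongrightarrow> e R) at_top" if R: "R \<in> T" for R
  proof (cases "k R = m")
    case True
    have "eventually (\<lambda>t::real. c R * t ^ k R / t ^ m = c R) at_top"
      using eventually_gt_at_top[of 0] by eventually_elim (auto simp: True)
    then show ?thesis by (simp add: e_def True tendsto_eventually)
  next
    case False
    then have m: "m = k R + (m - k R)" "0 < m - k R" using le[OF R] by auto
    have "((\<lambda>t::real. c R / t ^ (m - k R)) \<longlongrightarrow> 0) at_top"
      by (rule tendsto_divide_0[OF tendsto_const])
         (intro filterlim_at_top_imp_at_infinity filterlim_pow_at_top m(2) filterlim_ident)
    moreover have "eventually (\<lambda>t::real. c R / t ^ (m - k R) = c R * t ^ k R / t ^ m) at_top"
      using eventually_gt_at_top[of 0]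
    proof eventually_elim
      case (elim t)
      have "t ^ m = t ^ k R * t ^ (m - k R)" using m(1) by (metis power_add)
      then show ?case using elim by simp
    qed
    ultimately have "((\<lambda>t. c R * t ^ k R / t ^ m) \<longlongrightarrow> 0) at_top" using tendsto_cong by fast
    then show ?thesis by (simp add: e_def False)
  qed
  have "m \<in> k ` T" unfolding m_def using T by (intro Max_in) auto
  then obtain R where R: "R \<in> T" "k R = m" by auto
  have pos: "(\<Sum>R\<in>T. e R) \<noteq> 0"
    using sum_pos2[OF T(1) R(1), of e] c R by (force simp: e_def intro: less_imp_le)
  have "((\<lambda>t. (c S * t ^ k S / t ^ m) / (\<Sum>R\<in>T. c R * t ^ k R / t ^ m)) \<longlongrightarrow> e S / (\<Sum>R\<in>T. e R)) at_top"
    by (intro tendsto_divide tendsto_sum lim T pos)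
  moreover have "eventually (\<lambda>t. (c S * t ^ k S / t ^ m) / (\<Sum>R\<in>T. c R * t ^ k R / t ^ m)
        = c S * t ^ k S / (\<Sum>R\<in>T. c R * t ^ k R)) at_top"
    using eventually_gt_at_top[of 0]
    by eventually_elim (simp flip: sum_divide_distrib)
  ultimately show ?thesis using tendsto_cong by fast
qed

lemma pmf_tableau_pmf_limit:
  fixes \<alpha> \<beta> :: ennreal
  assumes "0 < \<alpha>" "0 < \<beta>" "\<alpha> = \<infinity> \<or> \<beta> = \<infinity>"
  shows "((\<lambda>t. pmf (fin_tableau_pmf n (if \<alpha> = \<infinity> then t else enn2real \<alpha>)
                                     (if \<beta> = \<infinity> then t else enn2real \<beta>)) S)
          \<longlongrightarrow> pmf (tableau_pmf n \<alpha> \<beta>) S) at_top"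
proof -
  define x where "x t = (if \<alpha> = \<infinity> then t else enn2real \<alpha>)" for t
  define y where "y t = (if \<beta> = \<infinity> then t else enn2real \<beta>)" for t
  define p where "p S t = pmf (fin_tableau_pmf n (x t) (y t)) S" for S t
  have xy: "0 < x t" "0 < y t" if "0 < t" for t
    using assms that by (auto simp: x_def y_def enn2real_positive_iff less_top)
  have p_out: "eventually (\<lambda>t. p S t = 0) at_top" if "S \<notin> tableaux n" for S
    using eventually_gt_at_top[of 0]
    by eventually_elim (use that in \<open>simp add: p_def pmf_fin_tableau_pmf xy\<close>)
  define k where "k S = (if \<alpha> = \<infinity> then num_symb Alpha S else 0)
     + (if \<beta> = \<infinity> then num_symb Beta S else 0)" for S
  define c where "c S = (if \<alpha> = \<infinity> then 1 else enn2real \<alpha> ^ num_symb Alpha S)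
     * (if \<beta> = \<infinity> then 1 else enn2real \<beta> ^ num_symb Beta S)" for S
  have c: "0 < c S" for S
    using assms by (auto simp: c_def enn2real_positive_iff less_top)
  have w: "weight (x t) (y t) S = c S * t ^ k S" for t S
    by (simp add: weight_def x_def y_def c_def k_def power_add)
  have ex: "\<exists>l. (p S \<longlongrightarrow> l) at_top" for S
  proof (cases "S \<in> tableaux n")
    case True
    obtain l where "((\<lambda>t. c S * t ^ k S / (\<Sum>R\<in>tableaux n. c R * t ^ k R)) \<longlongrightarrow> l) at_top"
      using monomial_ratio_limit[OF finite_tableaux True, of c k] c by blast
    moreover have "eventually (\<lambda>t. c S * t ^ k S / (\<Sum>R\<in>tableaux n. c R * t ^ k R) = p S t) at_top"
      using eventually_gt_at_top[of 0]
      by eventually_elim (simp add: p_def pmf_fin_tableau_pmf xy True partition_fun_def w)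
    ultimately show ?thesis using tendsto_cong by fast
  next
    case False
    then show ?thesis using tendsto_eventually[OF p_out] by blast
  qed
  then have lim: "(p S \<longlongrightarrow> Lim at_top (p S)) at_top" for S
    by (metis tendsto_Lim trivial_limit_at_top_linorder)
  have "pmf (embed_pmf (\<lambda>S. Lim at_top (p S))) S = Lim at_top (p S)"
  proof (rule pmf_embed_finite[OF finite_tableaux[of n]])
    show "0 \<le> Lim at_top (p S)" for S
      by (rule tendsto_lowerbound[OF lim]) (auto simp: p_def)
    show "Lim at_top (p S) = 0" if "S \<notin> tableaux n" for S
      by (intro tendsto_Lim tendsto_eventually p_out that) simp
    have "((\<lambda>t. \<Sum>S\<in>tableaux n. p S t) \<longlongrightarrow> (\<Sum>S\<in>tableaux n. Lim at_top (p S))) at_top"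
      by (intro tendsto_sum lim)
    moreover have "eventually (\<lambda>t. (\<Sum>S\<in>tableaux n. p S t) = 1) at_top"
      using eventually_gt_at_top[of 0]
    proof eventually_elim
      case (elim t)
      show ?case using partition_fun_pos[OF xy[OF elim], of n]
        by (simp add: p_def pmf_fin_tableau_pmf xy elim partition_fun_def flip: sum_divide_distrib)
    qed
    ultimately show "(\<Sum>S\<in>tableaux n. Lim at_top (p S)) = 1"
      by (intro tendsto_unique[OF trivial_limit_at_top_linorder _ tendsto_eventually])
  qed
  moreover have "tableau_pmf n \<alpha> \<beta> = embed_pmf (\<lambda>S. Lim at_top (p S))"
    using assms(3) by (auto simp: tableau_pmf_def p_def[abs_def] x_def y_def)
  ultimately have "pmf (tableau_pmf n \<alpha> \<beta>) S = Lim at_top (p S)" by simp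
  then have "(p S \<longlongrightarrow> pmf (tableau_pmf n \<alpha> \<beta>) S) at_top" using lim[of S] by simp
  then show ?thesis by (simp only: p_def[abs_def] x_def y_def)
qed

definition var_formula :: "nat \<Rightarrow> real \<Rightarrow> real \<Rightarrow> real" where
  "var_formula n a b =
     real n * ((real n - 1) * (real n - 2) * (real n + 4 * a + 4 * b - 1)
               + 6 * (real n - 1) * (a + b)\<^sup>2 + 12 * a * b * (a + b - 1))
     / (12 * (real n + a + b - 1)\<^sup>2 * (real n + a + b - 2))"

text \<open>
  At \<open>n = 1\<close>, \<open>a + b = 1\<close> the quotient in \<open>var_formula\<close> is \<open>0 / 0\<close>.  Its continuous
  extension is \<open>a * b / (a + b)\<^sup>2\<close>; the line \<open>a + b = 1\<close> itself has to be left out of the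
  limit, since there the value in HOL is \<open>0\<close>.
\<close>

lemma var_formula_1_continuous_extension:
  fixes a b :: real
  assumes "a + b = 1"
  shows "((\<lambda>(x, y). var_formula 1 x y) \<longlongrightarrow> a * b / (a + b)\<^sup>2) (at (a, b) within {(x, y). x + y \<noteq> 1})"
proof -
  have "((\<lambda>z. fst z * snd z / (fst z + snd z)\<^sup>2) \<longlongrightarrow> a * b / (a + b)\<^sup>2)
          (at (a, b) within {(x, y). x + y \<noteq> 1})"
    using assms by (auto intro!: tendsto_eq_intros)
  moreover have "eventually (\<lambda>z. fst z * snd z / (fst z + snd z)\<^sup>2 = (case z of (x, y) \<Rightarrow> var_formula 1 x y))
          (at (a, b) within {(x, y). x + y \<noteq> 1})"
    unfolding eventually_at_filter
    by (rule always_eventually) (auto simp: var_formula_def)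
  ultimately show ?thesis using tendsto_cong by fast
qed

end

theory Submission
  imports Defs
begin

text \<open>
  Cut off the first column of a staircase tableau.  What remains is a tableau of one size less,
  and the column is constrained by it only through the rows that contain no \<open>\<beta>\<close>: the column may
  be non-empty only in these rows and in its own diagonal box at the bottom.  So one keeps
  track of the number \<open>r\<close> of \<open>\<beta>\<close>-free rows.  For a function \<open>h\<close> of the number \<open>A\<close> of diagonal
  \<open>\<alpha>\<close>'s let \<open>T n h z\<close> be the sum over the tableaux of size \<open>n\<close> of weight times \<open>z ^ r\<close> times
  \<open>h A\<close>.  A column that starts with \<open>\<alpha>\<close> at the bottom is empty above it, adds a free row and
  raises \<open>A\<close> by one.  A column that starts with \<open>\<beta>\<close> leaves \<open>A\<close> alone, and the total weight of its
  fillings is explicit (\<open>sum_column_fillings\<close>), because from the bottom up every free row is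
  empty or a \<open>\<beta>\<close> until possibly an \<open>\<alpha>\<close> ends the column.  Together this gives, with the forward
  difference \<open>\<Delta> h k = h (k + 1) - h k\<close>,
  \<open>T (n + 1) h z = \<alpha> z T n (\<Delta> h) z + (\<alpha> z + \<beta>) T n h (z + \<beta>)\<close> (\<open>tableau_sum_Suc\<close>).

  Differences lower the degree of \<open>h\<close>, so the recursion is solved for \<open>h = 1\<close>, then for
  \<open>h k = k\<close>, then for \<open>h k = k (k - 1)\<close>.  In the variable \<open>c = z / \<beta>\<close> the shift \<open>z + \<beta>\<close>
  becomes \<open>c + 1\<close>, and each solution is \<open>(\<alpha> \<beta>) ^ n\<close> times a polynomial in \<open>n\<close> and \<open>c\<close>
  times a rising factorial of \<open>a + c\<close>.  At \<open>z = 1\<close>, that is \<open>c = b\<close>, the quotients of these sums are the mean and the second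
  factorial moment of \<open>A\<close>; the rising factorials cancel up to one or two factors.

  Infinite parameters need no combinatorics of their own.  The two moments are rational functions
  of \<open>a\<close> and \<open>b\<close>, and the expectation under the limiting distribution is the limit of the
  expectations since there are finitely many tableaux
  (\<open>expectation_tableau_pmf_by_continuity\<close>).  When both parameters are infinite, the
  conditions on \<open>n\<close> say that the denominators do not vanish at \<open>a = b = 0\<close>.  For \<open>n = 1\<close>
  the second factorial moment is \<open>0\<close>, which settles the case \<open>a + b = 1\<close> where its general formula is \<open>0 / 0\<close>.
\<close>

section \<open>Fillings of a single column\<close>

definition column_fillings :: "nat set \<Rightarrow> (nat \<rightharpoonup> symb) set" where
  "column_fillings R = {g. dom g \<subseteq> R \<and> (\<forall>i i'. g i = Some Alpha \<and> i' < i \<longrightarrow> g i' = None)}"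

text \<open>
  In a column whose available rows are \<open>R\<close>, the variable \<open>z\<close> marks the rows of \<open>R\<close> that are still
  free of \<open>\<beta>\<close> afterwards.
\<close>

definition entry_weight :: "real \<Rightarrow> real \<Rightarrow> real \<Rightarrow> symb option \<Rightarrow> real" where
  "entry_weight x y z e = (case e of None \<Rightarrow> z | Some Alpha \<Rightarrow> x * z | Some Beta \<Rightarrow> y)"

lemma entry_weight_simps [simp]:
  "entry_weight x y z None = z"
  "entry_weight x y z (Some Alpha) = x * z"
  "entry_weight x y z (Some Beta) = y"
  by (simp_all add: entry_weight_def)

lemma finite_column_fillings:
  assumes "finite R"
  shows "finite (column_fillings R)"
proof (rule finite_subset)
  have "finite (UNIV :: symb set)"
    by (rule finite_subset[of _ "{Alpha, Beta}"]) (use symb.exhaust in auto)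
  then show "finite (\<Union>B\<in>Pow R. {g. dom g = B \<and> ran g \<subseteq> (UNIV :: symb set)})"
    using assms by (intro finite_UN_I finite_set_of_finite_maps) (auto intro: finite_subset)
qed (auto simp: column_fillings_def)

lemma column_fillings_empty: "column_fillings {} = {Map.empty}"
  by (auto simp: column_fillings_def)

text \<open>
  An \<open>\<alpha>\<close> in the bottom row forces the rest of the column to be empty, a \<open>\<beta>\<close> there imposes
  nothing.
\<close>

lemma column_fillings_bottom_filled:
  assumes "\<forall>i\<in>R. i < m"
  shows "{g \<in> column_fillings (insert m R). g m \<noteq> None}
           = insert [m \<mapsto> Alpha] ((\<lambda>g. g(m \<mapsto> Beta)) ` column_fillings R)"
proof (intro set_eqI iffI)
  fix g assume "g \<in> {g \<in> column_fillings (insert m R). g m \<noteq> None}"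
  then have dom: "dom g \<subseteq> insert m R"
    and alpha: "\<And>i i'. g i = Some Alpha \<Longrightarrow> i' < i \<Longrightarrow> g i' = None" and gm: "g m \<noteq> None"
    by (auto simp: column_fillings_def)
  from gm consider "g m = Some Alpha" | "g m = Some Beta"
    by (metis not_None_eq symb.exhaust)
  then show "g \<in> insert [m \<mapsto> Alpha] ((\<lambda>g. g(m \<mapsto> Beta)) ` column_fillings R)"
  proof cases
    case 1
    have "g i = [m \<mapsto> Alpha] i" for i
      using 1 alpha[OF 1, of i] assms dom by (cases "g i") auto
    then show ?thesis by auto
  next
    case 2
    then have "g = (g(m := None))(m \<mapsto> Beta)" by auto
    moreover have "g(m := None) \<in> column_fillings R"
      using dom alpha by (auto simp: column_fillings_def)
    ultimately show ?thesis by blast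
  qed
next
  fix g assume "g \<in> insert [m \<mapsto> Alpha] ((\<lambda>g. g(m \<mapsto> Beta)) ` column_fillings R)"
  then show "g \<in> {g \<in> column_fillings (insert m R). g m \<noteq> None}"
  proof
    assume "g \<in> (\<lambda>g. g(m \<mapsto> Beta)) ` column_fillings R"
    then obtain g' where g': "g = g'(m \<mapsto> Beta)" "g' \<in> column_fillings R" by auto
    have "i < m" if "g' i = Some Alpha" for i
      using that g'(2) assms by (auto simp: column_fillings_def)
    then show ?thesis using g' by (fastforce simp: column_fillings_def)
  qed (auto simp: column_fillings_def split: if_splits)
qed

lemma column_fillings_bottom_empty:
  assumes "m \<notin> R"
  shows "{g \<in> column_fillings (insert m R). g m = None} = column_fillings R"
  using assms by (auto simp: column_fillings_def)

text \<open>
  The factor \<open>f\<close> of the bottom symbol is \<open>1\<close> when the lemma serves the induction over \<open>R\<close> in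
  \<open>sum_column_fillings\<close>; in the recursion for tableaux the bottom box is the diagonal one, and \<open>f\<close>
  records how its symbol changes the number of diagonal \<open>\<alpha>\<close>'s.
\<close>

lemma sum_column_fillings_bottom_filled:
  fixes f :: "symb \<Rightarrow> real"
  assumes "finite R" "\<forall>i\<in>R. i < m"
  shows "(\<Sum>g \<in> {g \<in> column_fillings (insert m R). g m \<noteq> None}.
             f (the (g m)) * (\<Prod>i\<in>insert m R. entry_weight x y z (g i)))
         = f Alpha * (x * z ^ Suc (card R))
           + f Beta * (y * (\<Sum>g\<in>column_fillings R. \<Prod>i\<in>R. entry_weight x y z (g i)))"
proof -
  have m: "m \<notin> R" using assms(2) by blast
  let ?F = "\<lambda>g. f (the (g m)) * (\<Prod>i\<in>insert m R. entry_weight x y z (g i))"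
  have none: "g m = None" if "g \<in> column_fillings R" for g
    using that m by (auto simp: column_fillings_def)
  have inj: "inj_on (\<lambda>g. g(m \<mapsto> Beta)) (column_fillings R)"
    by (rule inj_onI) (metis none fun_upd_idem_iff fun_upd_upd)
  have notin: "[m \<mapsto> Alpha] \<notin> (\<lambda>g. g(m \<mapsto> Beta)) ` column_fillings R"
    by (auto dest!: fun_cong[of _ _ m])
  have prod_upd: "(\<Prod>i\<in>R. entry_weight x y z ((g(m \<mapsto> s)) i)) = (\<Prod>i\<in>R. entry_weight x y z (g i))" for g s
    using m by (intro prod.cong) auto
  have "(\<Sum>g \<in> {g \<in> column_fillings (insert m R). g m \<noteq> None}. ?F g)
      = ?F [m \<mapsto> Alpha] + (\<Sum>g \<in> column_fillings R. ?F (g(m \<mapsto> Beta)))"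
    unfolding column_fillings_bottom_filled[OF assms(2)]
    by (subst sum.insert)
       (auto simp: notin finite_column_fillings[OF assms(1)] sum.reindex[OF inj] simp del: fun_upd_apply)
  also have "?F [m \<mapsto> Alpha] = f Alpha * (x * z ^ Suc (card R))"
    using m assms(1) by (simp add: prod_upd del: fun_upd_apply) (simp add: mult_ac)
  also have "(\<Sum>g \<in> column_fillings R. ?F (g(m \<mapsto> Beta)))
      = f Beta * (y * (\<Sum>g\<in>column_fillings R. \<Prod>i\<in>R. entry_weight x y z (g i)))"
    using m assms(1) by (simp add: prod_upd sum_distrib_left del: fun_upd_apply) (simp add: mult_ac)
  finally show ?thesis .
qed

text \<open>
  If \<open>W\<close> denotes the sum on the left for a set of \<open>r\<close> rows, then adding a row at the bottom yields
  \<open>x z ^ (r + 1) + (y + z) W\<close>, from the three possible entries \<open>\<alpha>\<close>, \<open>\<beta>\<close> and empty.  The solution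
  of this linear recursion has the denominator \<open>y\<close>, which is cleared here; exactly the product
  \<open>y W\<close> occurs when a \<open>\<beta>\<close> is placed below the column.
\<close>

lemma sum_column_fillings:
  assumes "finite R"
  shows "y * (\<Sum>g\<in>column_fillings R. \<Prod>i\<in>R. entry_weight x y z (g i))
           = (x * z + y) * (z + y) ^ card R - x * z ^ Suc (card R)"
  using assms
proof (induction R rule: finite_linorder_max_induct)
  case empty
  then show ?case by (simp add: column_fillings_empty)
next
  case (insert m R)
  have m: "m \<notin> R" using insert by blast
  let ?W = "\<lambda>R. \<Sum>g\<in>column_fillings R. \<Prod>i\<in>R. entry_weight x y z (g i)"
  let ?C = "column_fillings (insert m R)"
  have fin: "finite ?C" using insert by (simp add: finite_column_fillings)
  have "?W (insert m R) = (\<Sum>g\<in>{g \<in> ?C. g m \<noteq> None}. \<Prod>i\<in>insert m R. entry_weight x y z (g i))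
      + (\<Sum>g\<in>{g \<in> ?C. g m = None}. \<Prod>i\<in>insert m R. entry_weight x y z (g i))"
    using fin by (subst sum.union_disjoint[symmetric]) (auto intro!: sum.cong)
  also have "(\<Sum>g\<in>{g \<in> ?C. g m \<noteq> None}. \<Prod>i\<in>insert m R. entry_weight x y z (g i))
      = x * z ^ Suc (card R) + y * ?W R"
    using sum_column_fillings_bottom_filled[of R m "\<lambda>_. 1" x y z] insert by simp
  also have "(\<Sum>g\<in>{g \<in> ?C. g m = None}. \<Prod>i\<in>insert m R. entry_weight x y z (g i)) = z * ?W R"
    unfolding column_fillings_bottom_empty[OF m] sum_distrib_left
  proof (intro sum.cong refl)
    fix g assume "g \<in> column_fillings R"
    then have "g m = None" using m by (auto simp: column_fillings_def)
    then show "(\<Prod>i\<in>insert m R. entry_weight x y z (g i)) = z * (\<Prod>i\<in>R. entry_weight x y z (g i))"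
      using m insert(1) by simp
  qed
  finally have "y * ?W (insert m R) = y * x * z ^ Suc (card R) + (y + z) * (y * ?W R)"
    by (simp add: algebra_simps)
  also have "\<dots> = (x * z + y) * (z + y) ^ card (insert m R) - x * z ^ Suc (card (insert m R))"
    using m insert(1) unfolding insert.IH by (simp add: algebra_simps)
  finally show ?case .
qed

lemma prod_entry_weight:
  assumes "finite R" "dom g \<subseteq> R"
  shows "(\<Prod>i\<in>R. entry_weight x y z (g i))
           = x ^ card {i. g i = Some Alpha} * y ^ card {i. g i = Some Beta}
             * z ^ card {i \<in> R. g i \<noteq> Some Beta}"
proof -
  have "entry_weight x y z e = (if e = Some Alpha then x else 1)
      * (if e = Some Beta then y else 1) * (if e \<noteq> Some Beta then z else 1)" for e
    by (auto simp: entry_weight_def split: option.splits symb.splits)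
  then have "(\<Prod>i\<in>R. entry_weight x y z (g i))
      = x ^ card {i \<in> R. g i = Some Alpha} * y ^ card {i \<in> R. g i = Some Beta}
        * z ^ card {i \<in> R. g i \<noteq> Some Beta}"
    using assms(1) by (simp add: prod.distrib prod.If_cases Int_def conj_commute del: not_None_eq)
  moreover have "{i \<in> R. g i = Some s} = {i. g i = Some s}" for s
    using assms(2) by auto
  ultimately show ?thesis by simp
qed

section \<open>Attaching a first column\<close>

definition beta_free_rows :: "nat \<Rightarrow> (nat \<times> nat \<rightharpoonup> symb) \<Rightarrow> nat set" where
  "beta_free_rows n S = {i \<in> {1..n}. \<forall>j. S (i, j) \<noteq> Some Beta}"

definition attach_column :: "(nat \<rightharpoonup> symb) \<Rightarrow> (nat \<times> nat \<rightharpoonup> symb) \<Rightarrow> (nat \<times> nat \<rightharpoonup> symb)" where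
  "attach_column g S = (\<lambda>(i, j). if j = 0 then None else if j = 1 then g i else S (i, j - 1))"

text \<open>
  The columns that can be attached to a tableau \<open>S\<close> of size \<open>n\<close>; row \<open>Suc n\<close> is new, and its box in
  the attached column lies on the diagonal.
\<close>

definition first_columns :: "nat \<Rightarrow> (nat \<times> nat \<rightharpoonup> symb) \<Rightarrow> (nat \<rightharpoonup> symb) set" where
  "first_columns n S =
     {g \<in> column_fillings (insert (Suc n) (beta_free_rows n S)). g (Suc n) \<noteq> None}"

lemma beta_free_rows_less: "\<forall>i\<in>beta_free_rows n S. i < Suc n"
  by (auto simp: beta_free_rows_def)

lemma finite_beta_free_rows [simp]: "finite (beta_free_rows n S)"
  by (simp add: beta_free_rows_def)

lemma finite_first_columns: "finite (first_columns n S)"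
  by (simp add: first_columns_def finite_column_fillings)

lemma attach_column_simps [simp]:
  "attach_column g S (i, 0) = None"
  "attach_column g S (i, Suc 0) = g i"
  "attach_column g S (i, Suc (Suc j)) = S (i, Suc j)"
  by (simp_all add: attach_column_def)

lemma tableaux_outside:
  assumes "S \<in> tableaux n" "(i, j) \<notin> boxes n"
  shows "S (i, j) = None"
  using assms unfolding tableaux_def by blast

lemma attach_column_in_tableaux:
  assumes S: "S \<in> tableaux n" and g: "g \<in> first_columns n S"
  shows "attach_column g S \<in> tableaux (Suc n)"
proof -
  have dom_g: "i = Suc n \<or> i \<in> beta_free_rows n S" if "g i \<noteq> None" for i
    using that g by (auto simp: first_columns_def column_fillings_def)
  have g_alpha: "g i' = None" if "g i = Some Alpha" "i' < i" for i i'
    using that g by (auto simp: first_columns_def column_fillings_def)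
  have S_beta: "S (i, j') = None" if "S (i, j) = Some Beta" "j' < j" for i j j'
    using that S unfolding tableaux_def by blast
  have S_alpha: "S (i', j) = None" if "S (i, j) = Some Alpha" "i' < i" for i i' j
    using that S unfolding tableaux_def by blast
  have dom_S: "(i, j) \<in> boxes n" if "S (i, j) \<noteq> None" for i j
    using that tableaux_outside[OF S, of i j] by metis
  have diag_S: "S (i, j) \<noteq> None" if "(i, j) \<in> diagonal n" for i j
    using that S unfolding tableaux_def by blast
  have no_beta: "g i = None" if "S (i, j) = Some Beta" for i j
    proof (rule ccontr)
    assume "g i \<noteq> None"
    from dom_g[OF this] dom_S[of i j] that show False
      by (auto simp: beta_free_rows_def boxes_def)
  qed
  let ?S = "attach_column g S"
  have "dom ?S \<subseteq> boxes (Suc n)"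
  proof
    fix p assume "p \<in> dom ?S"
    then obtain i j where p: "p = (i, j)" "?S (i, j) \<noteq> None" by (cases p) auto
    show "p \<in> boxes (Suc n)"
    proof (cases "j = 0 \<or> j = 1")
      case True
      then show ?thesis using p dom_g[of i] by (auto simp: boxes_def beta_free_rows_def)
    next
      case False
      then obtain k where k: "j = Suc (Suc k)" by (metis One_nat_def not0_implies_Suc)
      show ?thesis using p dom_S[of i "Suc k"] by (simp add: k boxes_def)
    qed
  qed
  moreover have "diagonal (Suc n) \<subseteq> dom ?S"
  proof
    fix p assume "p \<in> diagonal (Suc n)"
    then obtain i j where p: "p = (i, Suc j)" "i + j = Suc n" "1 \<le> i"
      by (cases p; cases "snd p") (auto simp: diagonal_def boxes_def)
    show "p \<in> dom ?S"
    proof (cases j)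
      case 0
      then show ?thesis using p g by (auto simp: first_columns_def)
    next
      case (Suc k)
      then show ?thesis using p diag_S[of i "Suc k"] by (auto simp: diagonal_def boxes_def)
    qed
  qed
  moreover have "?S (i, j') = None" if "?S (i, j) = Some Beta" "j' < j" for i j j'
    using that S_beta[of i "j - 1" "j' - 1"] no_beta[of i "j - 1"]
    by (auto simp: attach_column_def split: if_splits)
  moreover have "?S (i', j) = None" if "?S (i, j) = Some Alpha" "i' < i" for i i' j
    using that S_alpha[of i "j - 1" i'] g_alpha[of i i']
    by (auto simp: attach_column_def split: if_splits)
  ultimately show ?thesis unfolding tableaux_def by blast
qed

lemma detach_column_in_tableaux:
  assumes S: "S \<in> tableaux (Suc n)"
  defines "S' \<equiv> (\<lambda>(i, j). if j = 0 then None else S (i, Suc j))"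
  defines "g \<equiv> (\<lambda>i. S (i, 1))"
  shows "S' \<in> tableaux n" "g \<in> first_columns n S'" "attach_column g S' = S"
proof -
  have S_beta: "S (i, j') = None" if "S (i, j) = Some Beta" "j' < j" for i j j'
    using that S unfolding tableaux_def by blast
  have S_alpha: "S (i', j) = None" if "S (i, j) = Some Alpha" "i' < i" for i i' j
    using that S unfolding tableaux_def by blast
  have dom_S: "(i, j) \<in> boxes (Suc n)" if "S (i, j) \<noteq> None" for i j
    using that tableaux_outside[OF S, of i j] by metis
  have diag_S: "S (i, j) \<noteq> None" if "(i, j) \<in> diagonal (Suc n)" for i j
    using that S unfolding tableaux_def by blast
  have "dom S' \<subseteq> boxes n"
  proof
    fix p assume "p \<in> dom S'"
    then obtain i j where p: "p = (i, Suc j)" "S (i, Suc (Suc j)) \<noteq> None"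
      by (cases p; cases "snd p") (auto simp: S'_def split: if_splits)
    show "p \<in> boxes n" using dom_S[OF p(2)] p(1) by (simp add: boxes_def)
  qed
  moreover have "diagonal n \<subseteq> dom S'"
  proof
    fix p assume "p \<in> diagonal n"
    then obtain i j where p: "p = (i, Suc j)" "i + j = n" "1 \<le> i"
      by (cases p; cases "snd p") (auto simp: diagonal_def boxes_def)
    show "p \<in> dom S'"
      using p diag_S[of i "Suc (Suc j)"] by (auto simp: S'_def diagonal_def boxes_def)
  qed
  moreover have "S' (i, j') = None" if "S' (i, j) = Some Beta" "j' < j" for i j j'
    using that S_beta[of i "Suc j" "Suc j'"] by (auto simp: S'_def split: if_splits)
  moreover have "S' (i', j) = None" if "S' (i, j) = Some Alpha" "i' < i" for i i' j
    using that S_alpha[of i "Suc j" i'] by (auto simp: S'_def split: if_splits)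
  ultimately show "S' \<in> tableaux n" unfolding tableaux_def by blast
  have "i = Suc n \<or> i \<in> beta_free_rows n S'" if "g i \<noteq> None" for i
  proof -
    have "S' (i, j) \<noteq> Some Beta" for j
      using that S_beta[of i "Suc j" 1] by (auto simp: S'_def g_def)
    then show ?thesis
      using dom_S[of i 1] that by (auto simp: g_def boxes_def beta_free_rows_def)
  qed
  moreover have "g (Suc n) \<noteq> None"
    using diag_S[of "Suc n" 1] by (simp add: g_def diagonal_def boxes_def)
  ultimately show "g \<in> first_columns n S'"
    using S_alpha by (auto simp: first_columns_def column_fillings_def g_def)
  have "S (i, 0) = None" for i
    using S by (rule tableaux_outside) (simp add: boxes_def)
  then show "attach_column g S' = S"
    by (auto simp: fun_eq_iff attach_column_def g_def S'_def)
qed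

text \<open>
  The two sides of the bijection see the same constraints: a \<open>\<beta>\<close> in a later column empties its row
  to the left, so the first column lives on the \<open>\<beta>\<close>-free rows, while a symbol in the first column
  has nothing to its left and an \<open>\<alpha>\<close> acts within its own column only.
\<close>

lemma bij_betw_attach_column:
  "bij_betw (\<lambda>(S, g). attach_column g S) (SIGMA S:tableaux n. first_columns n S) (tableaux (Suc n))"
proof (rule bij_betw_imageI)
  show "inj_on (\<lambda>(S, g). attach_column g S) (SIGMA S:tableaux n. first_columns n S)"
  proof (rule inj_onI, clarify)
    fix S g S' g'
    assume S: "S \<in> tableaux n" "S' \<in> tableaux n"
      and eq: "attach_column g S = attach_column g' S'"
    have "g i = g' i" for i using fun_cong[OF eq, of "(i, 1)"] by simp
    moreover have "S (i, j) = S' (i, j)" for i j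
    proof (cases j)
      case 0
      then show ?thesis using S by (auto simp: tableaux_outside boxes_def)
    next
      case (Suc k)
      then show ?thesis using fun_cong[OF eq, of "(i, Suc (Suc k))"] by simp
    qed
    ultimately show "S = S' \<and> g = g'" by (auto simp: fun_eq_iff)
  qed
  show "(\<lambda>(S, g). attach_column g S) ` (SIGMA S:tableaux n. first_columns n S) = tableaux (Suc n)"
  proof (intro equalityI subsetI)
    fix S assume "S \<in> tableaux (Suc n)"
    from detach_column_in_tableaux[OF this]
    show "S \<in> (\<lambda>(S, g). attach_column g S) ` (SIGMA S:tableaux n. first_columns n S)"
      by force
  qed (auto intro: attach_column_in_tableaux)
qed

lemma num_symb_attach_column:
  assumes S: "S \<in> tableaux n" and g: "g \<in> first_columns n S"
  shows "num_symb s (attach_column g S) = num_symb s S + card {i. g i = Some s}"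
proof -
  have "finite (dom g)"
    using g by (auto simp: first_columns_def column_fillings_def intro: finite_subset[of _ "insert (Suc n) (beta_free_rows n S)"])
  then have fin_g: "finite {i. g i = Some s}" by (rule rev_finite_subset) auto
  have fin_S: "finite {p. S p = Some s}"
    by (rule finite_subset[OF _ finite_boxes[of n]]) (use tableaux_outside[OF S] in fastforce)
  have eq: "{p. attach_column g S p = Some s}
      = (\<lambda>(i, j). (i, Suc j)) ` {p. S p = Some s} \<union> (\<lambda>i. (i, 1)) ` {i. g i = Some s}"
    (is "?L = ?A \<union> ?B")
  proof (intro set_eqI iffI)
    fix p assume p: "p \<in> ?L"
    then obtain i j where [simp]: "p = (i, Suc j)"
      by (cases p; cases "snd p") auto
    show "p \<in> ?A \<union> ?B" using p by (cases j) (auto simp: image_iff)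
  next
    fix p assume "p \<in> ?A \<union> ?B"
    moreover have "S (i, 0) = None" for i
      using S by (auto simp: tableaux_outside boxes_def)
    ultimately show "p \<in> ?L" by (auto simp: attach_column_def)
  qed
  have "?A \<inter> ?B = {}"
    using tableaux_outside[OF S] by (auto simp: boxes_def)
  then show ?thesis
    unfolding num_symb_def eq using fin_g fin_S
    by (subst card_Un_disjoint) (auto simp: card_image inj_on_def)
qed

lemma diag_alphas_attach_column:
  assumes S: "S \<in> tableaux n"
  shows "diag_alphas (Suc n) (attach_column g S)
           = diag_alphas n S + (if g (Suc n) = Some Alpha then 1 else 0)"
proof -
  let ?A = "(\<lambda>(i, j). (i, Suc j)) ` {p \<in> diagonal n. S p = Some Alpha}"
  let ?B = "if g (Suc n) = Some Alpha then {(Suc n, 1 :: nat)} else {}"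
  have fin: "finite {p \<in> diagonal n. S p = Some Alpha}"
    by (rule finite_subset[OF _ finite_boxes[of n]]) (auto simp: diagonal_def)
  have eq: "{p \<in> diagonal (Suc n). attach_column g S p = Some Alpha} = ?A \<union> ?B" (is "?L = _")
  proof (intro set_eqI iffI)
    fix p assume p: "p \<in> ?L"
    then obtain i j where [simp]: "p = (i, Suc j)"
      by (cases p; cases "snd p") auto
    show "p \<in> ?A \<union> ?B"
      using p by (cases j) (auto simp: image_iff diagonal_def boxes_def)
  next
    fix p assume "p \<in> ?A \<union> ?B"
    then show "p \<in> ?L"
      by (auto simp: attach_column_def diagonal_def boxes_def split: if_splits)
  qed
  have "?A \<inter> ?B = {}" by (auto simp: diagonal_def boxes_def)
  then have "card (?A \<union> ?B) = card ?A + card ?B"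
    using fin by (intro card_Un_disjoint) auto
  also have "card ?A = card {p \<in> diagonal n. S p = Some Alpha}"
    by (intro card_image) (auto simp: inj_on_def)
  also have "card ?B = (if g (Suc n) = Some Alpha then 1 else 0)" by simp
  finally show ?thesis unfolding diag_alphas_def eq .
qed

lemma beta_free_rows_attach_column:
  assumes S: "S \<in> tableaux n"
  shows "beta_free_rows (Suc n) (attach_column g S)
           = {i \<in> insert (Suc n) (beta_free_rows n S). g i \<noteq> Some Beta}"
proof -
  have out: "S (Suc n, j) = None" "S (i, 0) = None" for i j
    using S by (auto simp: tableaux_outside boxes_def)
  have "(\<forall>j. attach_column g S (i, j) \<noteq> Some Beta)
      \<longleftrightarrow> g i \<noteq> Some Beta \<and> (\<forall>j. S (i, j) \<noteq> Some Beta)" (is "?L \<longleftrightarrow> ?R") for i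
  proof
    assume L: ?L
    have "S (i, j) \<noteq> Some Beta" for j
      using L[rule_format, of "Suc j"] out(2) by (cases j) auto
    then show ?R using L[rule_format, of 1] by simp
  next
    assume ?R
    then show ?L by (auto simp: attach_column_def)
  qed
  then show ?thesis by (auto simp: beta_free_rows_def out le_Suc_eq)
qed

section \<open>The recursion for weighted sums over tableaux\<close>

text \<open>
  With \<open>h = (\<lambda>k. u ^ k)\<close> this is the joint generating function of the diagonal \<open>\<alpha>\<close>'s and the
  \<open>\<beta>\<close>-free rows.  A general \<open>h\<close> gives the moments directly, without differentiating in \<open>u\<close>.
\<close>

definition tableau_sum :: "real \<Rightarrow> real \<Rightarrow> nat \<Rightarrow> (nat \<Rightarrow> real) \<Rightarrow> real \<Rightarrow> real" where
  "tableau_sum x y n h z =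
     (\<Sum>S\<in>tableaux n. weight x y S * z ^ card (beta_free_rows n S) * h (diag_alphas n S))"

lemma tableaux_0: "tableaux 0 = {Map.empty}"
proof -
  have "boxes 0 = {}" by (auto simp: boxes_def)
  then show ?thesis by (auto simp: tableaux_def diagonal_def)
qed

lemma tableau_sum_0: "tableau_sum x y 0 h z = h 0"
  by (simp add: tableau_sum_def tableaux_0 weight_def num_symb_def beta_free_rows_def
      diag_alphas_def)

text \<open>
  The first columns with bottom symbol \<open>\<alpha>\<close> contribute \<open>x z ^ (r + 1)\<close> with the argument of \<open>h\<close>
  raised by one; those with bottom symbol \<open>\<beta>\<close> contribute
  \<open>(x z + y) (z + y) ^ r - x z ^ (r + 1)\<close>.  The subtracted term combines with the first
  contribution to the forward difference of \<open>h\<close>.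
\<close>

lemma tableau_sum_Suc:
  "tableau_sum x y (Suc n) h z
     = x * z * tableau_sum x y n (\<lambda>k. h (Suc k) - h k) z + (x * z + y) * tableau_sum x y n h (z + y)"
proof -
  let ?P = "\<lambda>S g. \<Prod>i\<in>insert (Suc n) (beta_free_rows n S). entry_weight x y z (g i)"
  define f where "f S s = h (diag_alphas n S + (if s = Alpha then 1 else 0))" for S s
  have term_eq: "weight x y (attach_column g S) * z ^ card (beta_free_rows (Suc n) (attach_column g S))
        * h (diag_alphas (Suc n) (attach_column g S))
      = weight x y S * (f S (the (g (Suc n))) * ?P S g)"
    if S: "S \<in> tableaux n" and g: "g \<in> first_columns n S" for S g
  proof -
    have "f S (the (g (Suc n))) = h (diag_alphas (Suc n) (attach_column g S))"
      using g by (auto simp: diag_alphas_attach_column[OF S] f_def first_columns_def)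
    moreover have "?P S g = x ^ card {i. g i = Some Alpha} * y ^ card {i. g i = Some Beta}
             * z ^ card (beta_free_rows (Suc n) (attach_column g S))"
      unfolding beta_free_rows_attach_column[OF S]
      using g by (intro prod_entry_weight) (auto simp: first_columns_def column_fillings_def)
    ultimately show ?thesis
      by (simp add: weight_def num_symb_attach_column[OF S g] power_add)
  qed
  have column_sum: "(\<Sum>g\<in>first_columns n S. f S (the (g (Suc n))) * ?P S g)
      = h (Suc (diag_alphas n S)) * (x * z ^ Suc (card (beta_free_rows n S)))
        + h (diag_alphas n S) * ((x * z + y) * (z + y) ^ card (beta_free_rows n S)
            - x * z ^ Suc (card (beta_free_rows n S)))" for S
    unfolding first_columns_def
    by (subst sum_column_fillings_bottom_filled[OF finite_beta_free_rows beta_free_rows_less])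
       (auto simp: f_def sum_column_fillings)
  have "tableau_sum x y (Suc n) h z
      = (\<Sum>(S, g)\<in>(SIGMA S:tableaux n. first_columns n S).
          weight x y S * (f S (the (g (Suc n))) * ?P S g))"
    unfolding tableau_sum_def
    by (subst sum.reindex_bij_betw[OF bij_betw_attach_column, symmetric])
       (rule sum.cong, auto simp: term_eq)
  also have "\<dots> = (\<Sum>S\<in>tableaux n. weight x y S *
      (\<Sum>g\<in>first_columns n S. f S (the (g (Suc n))) * ?P S g))"
    by (simp add: sum.Sigma[symmetric] finite_tableaux finite_first_columns sum_distrib_left)
  also have "\<dots> = x * z * tableau_sum x y n (\<lambda>k. h (Suc k) - h k) z
      + (x * z + y) * tableau_sum x y n h (z + y)"
    unfolding column_sum tableau_sum_def sum_distrib_left sum.distrib[symmetric]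
    by (intro sum.cong) (simp_all add: algebra_simps)
  finally show ?thesis .
qed

lemma tableau_sum_scale: "tableau_sum x y n (\<lambda>k. r * h k) z = r * tableau_sum x y n h z"
  by (simp add: tableau_sum_def sum_distrib_left mult_ac)

section \<open>Closed forms of the factorial moments of order at most two\<close>

context
  fixes x y a :: real
  assumes x: "x \<noteq> 0" and a: "a = 1 / x"
begin

text \<open>
  For \<open>z = y c\<close> every coefficient of the recursion has the factor \<open>x y\<close>, and the
  shift of \<open>z\<close> by \<open>y\<close> becomes a shift of \<open>c\<close> by one, which is what rising factorials absorb.
\<close>

lemma tableau_sum_Suc_normalised:
  "tableau_sum x y (Suc n) h (y * c)
     = x * y * (c * tableau_sum x y n (\<lambda>k. h (Suc k) - h k) (y * c)
                + (a + c) * tableau_sum x y n h (y * (c + 1)))"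
proof -
  have "x * (y * c) + y = x * y * (a + c)" using x by (simp add: a field_simps)
  moreover have "y * c + y = y * (c + 1)" by (simp add: algebra_simps)
  ultimately show ?thesis unfolding tableau_sum_Suc by (simp only:) (simp add: algebra_simps)
qed

lemma tableau_sum_1:
  "tableau_sum x y n (\<lambda>_. 1) (y * c) = (x * y) ^ n * pochhammer (a + c) n"
proof (induction n arbitrary: c)
  case (Suc n)
  have zero: "tableau_sum x y n (\<lambda>_. 0) (y * c) = 0" by (simp add: tableau_sum_def)
  show ?case
    unfolding tableau_sum_Suc_normalised pochhammer_rec Suc.IH
    by (simp add: zero) (simp add: algebra_simps)
qed (simp add: tableau_sum_0)

text \<open>
  Up to the common factors the recursion reads \<open>e (n + 1) c = 2 c + e n (c + 1)\<close>, whose solution is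
  \<open>e n c = n (n - 1 + 2 c)\<close>.  The size is written as a successor so that the rising factorial of
  length one less is natural.
\<close>

lemma tableau_sum_diag_alphas:
  "2 * tableau_sum x y (Suc n) real (y * c)
     = (x * y) ^ Suc n * (real (Suc n) * (real n + 2 * c)) * pochhammer (a + c) n"
proof (induction n arbitrary: c)
  case 0
  show ?case
    unfolding tableau_sum_Suc_normalised by (simp add: tableau_sum_0)
next
  case (Suc n)
  have "2 * tableau_sum x y (Suc (Suc n)) real (y * c)
      = x * y * (2 * c * ((x * y) ^ Suc n * pochhammer (a + c) (Suc n))
          + (a + c) * (2 * tableau_sum x y (Suc n) real (y * (c + 1))))"
    unfolding tableau_sum_Suc_normalised[of "Suc n" real]
    by (simp add: tableau_sum_1)
  also have "\<dots> = (x * y) ^ Suc (Suc n) * (2 * c + real (Suc n) * (real n + 2 * (c + 1)))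
      * pochhammer (a + c) (Suc n)"
    unfolding Suc.IH pochhammer_rec[of "a + c" n] by (simp add: algebra_simps)
  finally show ?case by (simp add: algebra_simps)
qed

text \<open>
  The forward difference of \<open>k (k - 1)\<close> is \<open>2 k\<close>.  With the mean inserted, the recursion becomes
  \<open>f (n + 1) c = 12 c n (n - 1 + 2 c) + f n (c + 1)\<close> up to the common factors, and summing it gives
  \<open>f n c = n (n - 1) (12 c\<^sup>2 + 12 (n - 2) c + (n - 2) (3 n - 5))\<close>; below, \<open>n\<close> is the size minus two.
\<close>

lemma tableau_sum_diag_alphas_pairs:
  "12 * tableau_sum x y (Suc (Suc n)) (\<lambda>k. real k * (real k - 1)) (y * c)
     = (x * y) ^ Suc (Suc n) * ((real n + 2) * (real n + 1)
         * (12 * c\<^sup>2 + 12 * real n * c + real n * (3 * real n + 1))) * pochhammer (a + c) n"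
proof (induction n arbitrary: c)
  case 0
  have diff: "(\<lambda>k. real (Suc k) * (real (Suc k) - 1) - real k * (real k - 1)) = (\<lambda>k. 2 * real k)"
    by (auto simp: algebra_simps)
  show ?case
    unfolding tableau_sum_Suc_normalised diff
    by (simp add: tableau_sum_0 tableau_sum_scale power2_eq_square)
next
  case (Suc n)
  let ?h = "\<lambda>k. real k * (real k - 1)"
  have diff: "(\<lambda>k. real (Suc k) * (real (Suc k) - 1) - real k * (real k - 1)) = (\<lambda>k. 2 * real k)"
    by (auto simp: algebra_simps)
  have "12 * tableau_sum x y (Suc (Suc (Suc n))) ?h (y * c)
      = x * y * (12 * c * (2 * tableau_sum x y (Suc (Suc n)) real (y * c))
          + (a + c) * (12 * tableau_sum x y (Suc (Suc n)) ?h (y * (c + 1))))"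
    unfolding tableau_sum_Suc_normalised[of "Suc (Suc n)"] diff
    by (simp add: tableau_sum_scale)
  also have "\<dots> = (x * y) ^ Suc (Suc (Suc n)) * (12 * c * (real n + 2) * (real n + 1 + 2 * c)
      + (real n + 2) * (real n + 1)
         * (12 * (c + 1)\<^sup>2 + 12 * real n * (c + 1) + real n * (3 * real n + 1)))
      * pochhammer (a + c) (Suc n)"
    unfolding Suc.IH tableau_sum_diag_alphas pochhammer_rec[of "a + c" n]
    by (simp add: algebra_simps)
  finally show ?case by (simp add: algebra_simps power2_eq_square)
qed

end

section \<open>The random tableau\<close>

lemma tableau_sum_at_1: "tableau_sum x y n h 1 = (\<Sum>S\<in>tableaux n. weight x y S * h (diag_alphas n S))"
  by (simp add: tableau_sum_def)

lemma expectation_fin_tableau_pmf: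
  assumes "0 < x" "0 < y"
  shows "measure_pmf.expectation (fin_tableau_pmf n x y) (\<lambda>S. h (diag_alphas n S))
           = tableau_sum x y n h 1 / tableau_sum x y n (\<lambda>_. 1) 1"
proof -
  have "measure_pmf.expectation (fin_tableau_pmf n x y) (\<lambda>S. h (diag_alphas n S))
      = (\<Sum>S\<in>tableaux n. h (diag_alphas n S) * pmf (fin_tableau_pmf n x y) S)"
    by (rule integral_measure_pmf_real[OF finite_tableaux])
       (auto simp: set_pmf_iff pmf_fin_tableau_pmf assms split: if_splits)
  also have "\<dots> = (\<Sum>S\<in>tableaux n. weight x y S * h (diag_alphas n S) / partition_fun n x y)"
    by (intro sum.cong) (simp_all add: pmf_fin_tableau_pmf assms mult_ac)
  finally show ?thesis
    by (simp add: tableau_sum_at_1 partition_fun_def sum_divide_distrib)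
qed

text \<open>
  At \<open>z = 1\<close> the normalised variable is \<open>c = 1 / y\<close>.  Of the two rising factorials only the last
  factor \<open>s + (n - 1)\<close> of the longer one survives in the quotient.
\<close>

lemma expectation_fin_diag_alphas:
  assumes x: "0 < x" and y: "0 < y" and n: "n \<ge> 1"
  shows "measure_pmf.expectation (fin_tableau_pmf n x y) (\<lambda>S. real (diag_alphas n S))
           = real n * (real n + 2 * (1 / y) - 1) / (2 * (real n + 1 / x + 1 / y - 1))"
proof -
  obtain m where m: "n = Suc m" using n by (cases n) auto
  define s where "s = 1 / x + 1 / y"
  have s: "0 < s" using x y by (simp add: s_def add_pos_pos)
  have pos: "0 < pochhammer s m" using s by (simp add: pochhammer_pos)
  have "2 * tableau_sum x y n real 1 = (x * y) ^ n * (real n * (real m + 2 * (1 / y))) * pochhammer s m"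
    using tableau_sum_diag_alphas[of x "1 / x" y m "1 / y"] x y by (simp add: m s_def)
  then have "tableau_sum x y n real 1
      = (x * y) ^ n * (real n * (real m + 2 * (1 / y))) * pochhammer s m / 2" by simp
  moreover have "tableau_sum x y n (\<lambda>_. 1) 1 = (x * y) ^ n * (pochhammer s m * (s + real m))"
    using tableau_sum_1[of x "1 / x" y n "1 / y"] x y by (simp add: m s_def pochhammer_Suc)
  ultimately have "tableau_sum x y n real 1 / tableau_sum x y n (\<lambda>_. 1) 1
      = ((x * y) ^ n * (real n * (real m + 2 * (1 / y))) * pochhammer s m / 2)
        / ((x * y) ^ n * (pochhammer s m * (s + real m)))"
    by (simp only:)
  also have "\<dots> = real n * (real m + 2 * (1 / y)) / (2 * (s + real m))"
    using x y pos by simp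
  finally show ?thesis
    unfolding expectation_fin_tableau_pmf[OF x y] by (simp add: m s_def algebra_simps)
qed

lemma expectation_fin_diag_alphas_pairs:
  assumes x: "0 < x" and y: "0 < y" and n: "n \<ge> 2"
  shows "measure_pmf.expectation (fin_tableau_pmf n x y)
             (\<lambda>S. real (diag_alphas n S) * (real (diag_alphas n S) - 1))
           = real n * (real n - 1)
               * (12 * (1 / y)\<^sup>2 + 12 * (real n - 2) * (1 / y) + (real n - 2) * (3 * real n - 5))
             / (12 * (real n + 1 / x + 1 / y - 1) * (real n + 1 / x + 1 / y - 2))"
proof -
  obtain m where m: "n = Suc (Suc m)" using n by (metis One_nat_def Suc_1 Suc_le_D Suc_le_mono)
  define s where "s = 1 / x + 1 / y"
  define w where "w = 1 / y"
  define p where "p = real n * (real n - 1) * (12 * w\<^sup>2 + 12 * (real n - 2) * w + (real n - 2) * (3 * real n - 5))"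
  have s: "0 < s" using x y by (simp add: s_def add_pos_pos)
  have pos: "0 < pochhammer s m" using s by (simp add: pochhammer_pos)
  have p: "p = (real m + 2) * (real m + 1) * (12 * w\<^sup>2 + 12 * real m * w + real m * (3 * real m + 1))"
    by (simp add: p_def m algebra_simps)
  have "12 * tableau_sum x y n (\<lambda>k. real k * (real k - 1)) 1 = (x * y) ^ n * p * pochhammer s m"
    using tableau_sum_diag_alphas_pairs[of x "1 / x" y m w] x y
    unfolding p by (simp add: m s_def w_def)
  then have "tableau_sum x y n (\<lambda>k. real k * (real k - 1)) 1
      = (x * y) ^ n * p * pochhammer s m / 12" by simp
  moreover have "tableau_sum x y n (\<lambda>_. 1) 1
      = (x * y) ^ n * (pochhammer s m * ((s + real m) * (s + real m + 1)))"
    using tableau_sum_1[of x "1 / x" y n w] x y by (simp add: m s_def w_def pochhammer_Suc add_ac)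
  ultimately have "tableau_sum x y n (\<lambda>k. real k * (real k - 1)) 1 / tableau_sum x y n (\<lambda>_. 1) 1
      = ((x * y) ^ n * p * pochhammer s m / 12)
        / ((x * y) ^ n * (pochhammer s m * ((s + real m) * (s + real m + 1))))"
    by (simp only:)
  also have "\<dots> = p / (12 * (s + real m + 1) * (s + real m))"
    using x y pos by simp
  also have "s + real m + 1 = real n + 1 / x + 1 / y - 1" by (simp add: m s_def)
  also have "s + real m = real n + 1 / x + 1 / y - 2" by (simp add: m s_def)
  finally show ?thesis
    unfolding expectation_fin_tableau_pmf[OF x y, of n "\<lambda>k. real k * (real k - 1)"] p_def w_def .
qed

text \<open>
  A tableau of size one has a single box.  This case is kept apart because the denominator
  \<open>n + a + b - 2\<close> of the general formula vanishes for \<open>n = 1\<close>, \<open>a + b = 1\<close>.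
\<close>

lemma expectation_fin_diag_alphas_pairs_1:
  assumes x: "0 < x" and y: "0 < y"
  shows "measure_pmf.expectation (fin_tableau_pmf 1 x y)
             (\<lambda>S. real (diag_alphas 1 S) * (real (diag_alphas 1 S) - 1)) = 0"
  unfolding expectation_fin_tableau_pmf[OF assms, of 1 "\<lambda>k. real k * (real k - 1)"]
  by (simp add: tableau_sum_Suc tableau_sum_0)

lemma set_pmf_tableau_pmf:
  assumes "0 < \<alpha>" "0 < \<beta>"
  shows "set_pmf (tableau_pmf n \<alpha> \<beta>) \<subseteq> tableaux n"
proof
  fix S assume "S \<in> set_pmf (tableau_pmf n \<alpha> \<beta>)"
  then have nz: "pmf (tableau_pmf n \<alpha> \<beta>) S \<noteq> 0" by (simp add: set_pmf_iff)
  show "S \<in> tableaux n"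
  proof (rule ccontr)
    assume S: "S \<notin> tableaux n"
    show False
    proof (cases "\<alpha> = \<infinity> \<or> \<beta> = \<infinity>")
      case True
      let ?p = "\<lambda>t. pmf (fin_tableau_pmf n (if \<alpha> = \<infinity> then t else enn2real \<alpha>)
                                     (if \<beta> = \<infinity> then t else enn2real \<beta>)) S"
      have "eventually (\<lambda>t. ?p t = 0) at_top"
        using eventually_gt_at_top[of 0]
        by eventually_elim
           (subst pmf_fin_tableau_pmf, use assms S in \<open>auto simp: enn2real_positive_iff less_top\<close>)
      then have "(?p \<longlongrightarrow> 0) at_top" by (rule tendsto_eventually)
      from tendsto_unique[OF trivial_limit_at_top_linorder
          pmf_tableau_pmf_limit[OF assms True, of n S] this] nz
      show False by simp
    next
      case False
      then show False
        using nz S assms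
        by (simp add: tableau_pmf_def pmf_fin_tableau_pmf enn2real_positive_iff less_top[symmetric])
    qed
  qed
qed

lemma tendsto_inverse_parameter:
  fixes \<gamma> :: ennreal
  assumes "0 < \<gamma>"
  shows "((\<lambda>t. 1 / (if \<gamma> = \<infinity> then t else enn2real \<gamma>)) \<longlongrightarrow> enn2real (inverse \<gamma>)) at_top"
proof (cases "\<gamma> = \<infinity>")
  case True
  have "((\<lambda>t::real. 1 / t) \<longlongrightarrow> 0) at_top"
    by (intro tendsto_divide_0[OF tendsto_const] filterlim_at_top_imp_at_infinity filterlim_ident)
  then show ?thesis using True by simp
next
  case False
  then obtain r where r: "\<gamma> = ennreal r" "0 < r"
    using assms by (cases \<gamma>) auto
  then show ?thesis by (simp add: inverse_ennreal inverse_eq_divide)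
qed

text \<open>
  A formula that is proved for finite parameters and is continuous in their inverses at the relevant
  point carries over to infinite parameters.  Only continuity at \<open>(a, b)\<close> is required of \<open>F\<close>, so
  for \<open>\<alpha> = \<beta> = \<infinity>\<close> the result is the value at the origin, although the limit
  is taken along the diagonal.
\<close>

lemma expectation_tableau_pmf_by_continuity:
  fixes \<alpha> \<beta> :: ennreal and F :: "real \<Rightarrow> real \<Rightarrow> real"
  assumes pos: "0 < \<alpha>" "0 < \<beta>"
    and formula: "\<And>x y. 0 < x \<Longrightarrow> 0 < y \<Longrightarrow>
      measure_pmf.expectation (fin_tableau_pmf n x y) f = F (1 / x) (1 / y)"
    and cont: "isCont (\<lambda>p. F (fst p) (snd p)) (enn2real (inverse \<alpha>), enn2real (inverse \<beta>))"
  shows "measure_pmf.expectation (tableau_pmf n \<alpha> \<beta>) f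
           = F (enn2real (inverse \<alpha>)) (enn2real (inverse \<beta>))"
proof -
  define x where "x t = (if \<alpha> = \<infinity> then t else enn2real \<alpha>)" for t
  define y where "y t = (if \<beta> = \<infinity> then t else enn2real \<beta>)" for t
  have xy: "0 < x t" "0 < y t" if "0 < t" for t
    using pos that by (auto simp: x_def y_def enn2real_positive_iff less_top)
  have lim_pmf: "((\<lambda>t. pmf (fin_tableau_pmf n (x t) (y t)) S) \<longlongrightarrow> pmf (tableau_pmf n \<alpha> \<beta>) S) at_top" for S
  proof (cases "\<alpha> = \<infinity> \<or> \<beta> = \<infinity>")
    case True
    then show ?thesis unfolding x_def y_def by (rule pmf_tableau_pmf_limit[OF pos])
  next
    case False
    then show ?thesis by (simp add: tableau_pmf_def x_def y_def less_top[symmetric])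
  qed
  have "((\<lambda>t. \<Sum>S\<in>tableaux n. f S * pmf (fin_tableau_pmf n (x t) (y t)) S)
      \<longlongrightarrow> (\<Sum>S\<in>tableaux n. f S * pmf (tableau_pmf n \<alpha> \<beta>) S)) at_top"
    by (intro tendsto_sum tendsto_mult tendsto_const lim_pmf)
  also have "(\<Sum>S\<in>tableaux n. f S * pmf (tableau_pmf n \<alpha> \<beta>) S)
      = measure_pmf.expectation (tableau_pmf n \<alpha> \<beta>) f"
    by (rule integral_measure_pmf_real[symmetric, OF finite_tableaux])
       (use set_pmf_tableau_pmf[OF pos] in blast)
  finally have "((\<lambda>t. \<Sum>S\<in>tableaux n. f S * pmf (fin_tableau_pmf n (x t) (y t)) S)
      \<longlongrightarrow> measure_pmf.expectation (tableau_pmf n \<alpha> \<beta>) f) at_top" .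
  moreover have "eventually (\<lambda>t. (\<Sum>S\<in>tableaux n. f S * pmf (fin_tableau_pmf n (x t) (y t)) S)
      = F (1 / x t) (1 / y t)) at_top"
    using eventually_gt_at_top[of 0]
  proof eventually_elim
    case (elim t)
    have "(\<Sum>S\<in>tableaux n. f S * pmf (fin_tableau_pmf n (x t) (y t)) S)
        = measure_pmf.expectation (fin_tableau_pmf n (x t) (y t)) f"
      by (rule integral_measure_pmf_real[symmetric, OF finite_tableaux])
         (auto simp: set_pmf_iff pmf_fin_tableau_pmf xy elim split: if_splits)
    then show ?case by (simp add: formula xy elim)
  qed
  ultimately have "((\<lambda>t. F (1 / x t) (1 / y t)) \<longlongrightarrow> measure_pmf.expectation (tableau_pmf n \<alpha> \<beta>) f) at_top"
    using tendsto_cong by fast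
  moreover have "((\<lambda>t. (1 / x t, 1 / y t)) \<longlongrightarrow> (enn2real (inverse \<alpha>), enn2real (inverse \<beta>))) at_top"
    unfolding x_def y_def by (intro tendsto_Pair tendsto_inverse_parameter pos)
  from isCont_tendsto_compose[OF cont this]
  have "((\<lambda>t. F (1 / x t) (1 / y t)) \<longlongrightarrow> F (enn2real (inverse \<alpha>)) (enn2real (inverse \<beta>))) at_top"
    by simp
  ultimately show ?thesis
    using tendsto_unique trivial_limit_at_top_linorder by blast
qed

lemma enn2real_inverse_pos:
  fixes \<gamma> :: ennreal
  assumes "0 < \<gamma>" "\<gamma> \<noteq> \<infinity>"
  shows "0 < enn2real (inverse \<gamma>)"
proof -
  obtain r where "\<gamma> = ennreal r" "0 < r"
    using assms by (cases \<gamma>) auto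
  then show ?thesis by (simp add: inverse_ennreal)
qed

lemma variance_diag_alphas:
  fixes \<alpha> \<beta> :: ennreal and n :: nat
  assumes "0 < \<alpha>" "0 < \<beta>"
  defines "P \<equiv> tableau_pmf n \<alpha> \<beta>"
  shows "measure_pmf.variance P (\<lambda>S. real (diag_alphas n S))
    = measure_pmf.expectation P (\<lambda>S. real (diag_alphas n S) * (real (diag_alphas n S) - 1))
      + measure_pmf.expectation P (\<lambda>S. real (diag_alphas n S))
      - (measure_pmf.expectation P (\<lambda>S. real (diag_alphas n S)))\<^sup>2"
proof -
  let ?A = "\<lambda>S. real (diag_alphas n S)"
  have int: "integrable (measure_pmf P) f" for f :: "_ \<Rightarrow> real"
    unfolding P_def
    by (rule integrable_measure_pmf_finite)
       (rule finite_subset[OF set_pmf_tableau_pmf[OF assms(1,2)] finite_tableaux])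
  have "measure_pmf.expectation P (\<lambda>S. (?A S)\<^sup>2)
      = measure_pmf.expectation P (\<lambda>S. ?A S * (?A S - 1) + ?A S)"
    by (intro Bochner_Integration.integral_cong) (auto simp: power2_eq_square algebra_simps)
  also have "\<dots> = measure_pmf.expectation P (\<lambda>S. ?A S * (?A S - 1)) + measure_pmf.expectation P ?A"
    by (rule Bochner_Integration.integral_add[OF int int])
  finally show ?thesis
    by (subst measure_pmf.variance_eq[OF int int]) simp
qed

lemma variance_from_factorial_moments:
  fixes N a b :: real
  assumes "N + a + b - 1 \<noteq> 0" "N + a + b - 2 \<noteq> 0"
  shows "N * (N - 1) * (12 * b\<^sup>2 + 12 * (N - 2) * b + (N - 2) * (3 * N - 5))
             / (12 * (N + a + b - 1) * (N + a + b - 2))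
           + N * (N + 2 * b - 1) / (2 * (N + a + b - 1))
           - (N * (N + 2 * b - 1) / (2 * (N + a + b - 1)))\<^sup>2
         = N * ((N - 1) * (N - 2) * (N + 4 * a + 4 * b - 1)
               + 6 * (N - 1) * (a + b)\<^sup>2 + 12 * a * b * (a + b - 1))
             / (12 * (N + a + b - 1)\<^sup>2 * (N + a + b - 2))"
proof -
  \<comment> \<open>Eliminating \<open>a\<close> in favour of the denominator leaves only the denominators \<open>d\<close> and \<open>d - 1\<close>.\<close>
  define d where "d = N + a + b - 1"
  have d: "d \<noteq> 0" "d - 1 \<noteq> 0" and a: "a = d + 1 - N - b" using assms by (simp_all add: d_def)
  have D: "N + a + b - 1 = d" "N + a + b - 2 = d - 1" by (simp_all add: d_def)
  show ?thesis
    unfolding D using d unfolding a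
    by (simp add: divide_simps power2_eq_square) algebra
qed

theorem theorem1p8:
  fixes \<alpha> \<beta> :: ennreal and a b :: real and n :: nat
  assumes "0 < \<alpha>" and "0 < \<beta>" and "n \<ge> 1"
    and "a = enn2real (inverse \<alpha>)" and "b = enn2real (inverse \<beta>)"
  shows "((\<alpha> = \<infinity> \<and> \<beta> = \<infinity> \<longrightarrow> n \<ge> 2) \<longrightarrow>
           measure_pmf.expectation (tableau_pmf n \<alpha> \<beta>) (\<lambda>S. real (diag_alphas n S))
             = real n * (real n + 2 * b - 1) / (2 * (real n + a + b - 1)))
       \<and> ((\<alpha> = \<infinity> \<and> \<beta> = \<infinity> \<longrightarrow> n \<ge> 3) \<longrightarrow>
           measure_pmf.variance (tableau_pmf n \<alpha> \<beta>) (\<lambda>S. real (diag_alphas n S))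
             = (if n = 1 \<and> a + b = 1 then a * b / (a + b)\<^sup>2 else var_formula n a b))"
proof -
  let ?A = "\<lambda>S. real (diag_alphas n S)"
  let ?E = "measure_pmf.expectation (tableau_pmf n \<alpha> \<beta>)"
  have nonneg: "0 \<le> a" "0 \<le> b" by (simp_all add: assms)
  have pos: "0 < a + b" if "\<not> (\<alpha> = \<infinity> \<and> \<beta> = \<infinity>)"
    using that nonneg enn2real_inverse_pos[of \<alpha>] enn2real_inverse_pos[of \<beta>] assms by force
  have mean: "?E ?A = real n * (real n + 2 * b - 1) / (2 * (real n + a + b - 1))"
    if "\<alpha> = \<infinity> \<and> \<beta> = \<infinity> \<longrightarrow> n \<ge> 2"
  proof -
    have nz: "real n + a + b - 1 \<noteq> 0"
      using that pos nonneg \<open>n \<ge> 1\<close> by (cases "\<alpha> = \<infinity> \<and> \<beta> = \<infinity>") auto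
    show ?thesis
      unfolding assms(4,5)
    proof (rule expectation_tableau_pmf_by_continuity[OF assms(1,2)])
      show "isCont (\<lambda>p. real n * (real n + 2 * snd p - 1) / (2 * (real n + fst p + snd p - 1)))
              (enn2real (inverse \<alpha>), enn2real (inverse \<beta>))"
        using nz by (intro continuous_intros) (simp add: assms(4,5))
    qed (rule expectation_fin_diag_alphas[OF _ _ \<open>n \<ge> 1\<close>])
  qed
  have variance: "measure_pmf.variance (tableau_pmf n \<alpha> \<beta>) ?A
      = (if n = 1 \<and> a + b = 1 then a * b / (a + b)\<^sup>2 else var_formula n a b)"
    if inf: "\<alpha> = \<infinity> \<and> \<beta> = \<infinity> \<longrightarrow> n \<ge> 3"
  proof (cases "n = 1")
    case True
    have "0 < a + b" using inf True pos by auto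
    have "?E (\<lambda>S. ?A S * (?A S - 1)) = 0"
      unfolding True
      by (rule expectation_tableau_pmf_by_continuity[OF assms(1,2), where F = "\<lambda>_ _. 0"])
         (use expectation_fin_diag_alphas_pairs_1 in simp_all)
    moreover have "?E ?A = b / (a + b)"
    proof -
      have "?E ?A = 2 * b / (2 * (a + b))" using mean inf by (simp add: True)
      also have "\<dots> = b / (a + b)" by (rule mult_divide_mult_cancel_left) simp
      finally show ?thesis .
    qed
    ultimately have "measure_pmf.variance (tableau_pmf n \<alpha> \<beta>) ?A = b / (a + b) - (b / (a + b))\<^sup>2"
      unfolding variance_diag_alphas[OF assms(1,2)] by simp
    also have "\<dots> = (b * (a + b) - b\<^sup>2) / (a + b)\<^sup>2"
      using \<open>0 < a + b\<close> by (simp add: diff_divide_distrib power_divide power2_eq_square)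
    also have "b * (a + b) - b\<^sup>2 = a * b" by (simp add: algebra_simps power2_eq_square)
    also have "a * b / (a + b)\<^sup>2 = (if n = 1 \<and> a + b = 1 then a * b / (a + b)\<^sup>2 else var_formula n a b)"
      by (simp add: True var_formula_def)
    finally show ?thesis .
  next
    case False
    then have n: "n \<ge> 2" using \<open>n \<ge> 1\<close> by simp
    have nz: "real n + a + b - 1 \<noteq> 0" "real n + a + b - 2 \<noteq> 0"
      using inf pos nonneg n by (cases "\<alpha> = \<infinity> \<and> \<beta> = \<infinity>"; auto)+
    have pairs: "?E (\<lambda>S. ?A S * (?A S - 1)) = real n * (real n - 1)
               * (12 * b\<^sup>2 + 12 * (real n - 2) * b + (real n - 2) * (3 * real n - 5))
             / (12 * (real n + a + b - 1) * (real n + a + b - 2))"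
      unfolding assms(4,5)
    proof (rule expectation_tableau_pmf_by_continuity[OF assms(1,2)])
      show "isCont (\<lambda>p. real n * (real n - 1)
               * (12 * (snd p)\<^sup>2 + 12 * (real n - 2) * snd p + (real n - 2) * (3 * real n - 5))
             / (12 * (real n + fst p + snd p - 1) * (real n + fst p + snd p - 2)))
              (enn2real (inverse \<alpha>), enn2real (inverse \<beta>))"
        using nz by (intro continuous_intros) (simp add: assms(4,5))
    qed (rule expectation_fin_diag_alphas_pairs[OF _ _ n])
    have "?E ?A = real n * (real n + 2 * b - 1) / (2 * (real n + a + b - 1))"
      using mean n by simp
    then show ?thesis
      unfolding variance_diag_alphas[OF assms(1,2)] pairs var_formula_def
      using variance_from_factorial_moments[OF nz] False by simp
  qed
  from mean variance show ?thesis by blast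
qed

end
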